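(* Let $X$ be a completely regular topological space and let $\alpha$ be a collection of families of open subsets of $X$ with $p(X)\subseteq\alpha\subseteq\kappa(X)$, such that $\alpha$ is a base of a topology on $C(X,\$)$. The following are equivalent: (1) $C_\alpha(X,\mathbb{R})$ is strongly Fréchet at the zero function $\overline{0}$; (2) $C_\alpha(X,\$)$ is strongly Fréchet at $X$; (3) for every decreasing sequence $(\mathcal P_n)_{n\in\omega}$ of open $\alpha$-covers of $X$, for each $n<\omega$ there exists $P_n\in\mathcal P_n$ so that each nonempty $\mathcal A\in\alpha$ contains all but finitely many of the elements of $(P_n)_{n\in\omega}$.
   Context: $C(X,\$)$ is the set of open subsets of $X$. For $A\subseteq X$, $\mathcal O_X(A)$ is the set of open sets containing $A$, and $\mathcal O_X(\mathcal A)=\bigcup_{A\in\mathcal A}\mathcal O_X(A)$. $p(X)$ is the topology on $C(X,\$)$ whose open sets are the unions of families $\mathcal O_X(F)$ with $F\subseteq X$ finite. A family $\mathcal A\subseteq C(X,\$)$ is compact if $\mathcal A=\mathcal O_X(\mathcal A)$ and whenever $\mathcal Q\subseteq C(X,\$)$ and $\bigcup\mathcal Q\in\mathcal A$, there is a finite $\mathcal S\subseteq\mathcal Q$ with $\bigcup\mathcal S\in\mathcal A$; $\kappa(X)$ is the collection of all compact families. $C_\alpha(X,\$)$ is $C(X,\$)$ with the topology generated by $\alpha$. $C_\alpha(X,\mathbb R)$ is $C(X,\mathbb R)$ with the topology having as subbase the sets $[\mathcal A,U]=\{f:f^{-1}(U)\in\mathcal A\}$, $\mathcal A\in\alpha$,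 $U\subseteq\mathbb R$ open. A family $\mathcal P\subseteq C(X,\$)$ is an (open) $\alpha$-cover of $X$ if $\mathcal P\cap\mathcal A\ne\varnothing$ for every $\mathcal A\in\alpha$ with $X\in\mathcal A$ (equivalently, every nonempty $\mathcal A\in\alpha$). A topological space $Y$ is strongly Fréchet at $y$ if, for every countably based filter $\mathcal H$ on $Y$ meshing with the neighborhood filter $\mathcal N(y)$ (every element of $\mathcal H$ meets every neighborhood of $y$), there is a countably based filter $\mathcal L$ finer than $\mathcal N(y)\vee\mathcal H$; equivalently, for every decreasing sequence $(A_n)$ of subsets with $y\in\bigcap_n\mathrm{cl}\,A_n$ there are $a_n\in A_n$ with $(a_n)$ converging to $y$. *)

theory Defs
  imports "HOL-Analysis.Analysis"
begin

text \<open>The carrier of \<open>C(X,$)\<close>.\<close>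

definition opens :: "'a topology \<Rightarrow> 'a set set" where
  "opens X = {U. openin X U}"

definition nbhd_family :: "'a topology \<Rightarrow> 'a set \<Rightarrow> 'a set set" where
  "nbhd_family X A = {U \<in> opens X. A \<subseteq> U}"

definition nbhd_families :: "'a topology \<Rightarrow> 'a set set \<Rightarrow> 'a set set" where
  "nbhd_families X \<A> = (\<Union>A\<in>\<A>. nbhd_family X A)"

text \<open>\<open>p(X)\<close> is given as the collection of its open sets.\<close>

definition p_families :: "'a topology \<Rightarrow> 'a set set set" where
  "p_families X = {\<Union>F\<in>\<F>. nbhd_family X F | \<F>. \<forall>F\<in>\<F>. finite F \<and> F \<subseteq> topspace X}"

definition compact_family :: "'a topology \<Rightarrow> 'a set set \<Rightarrow> bool" where
  "compact_family X \<A> \<longleftrightarrow>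
     \<A> \<subseteq> opens X \<and> \<A> = nbhd_families X \<A> \<and>
     (\<forall>\<Q>. \<Q> \<subseteq> opens X \<and> \<Union>\<Q> \<in> \<A> \<longrightarrow> (\<exists>\<S>. finite \<S> \<and> \<S> \<subseteq> \<Q> \<and> \<Union>\<S> \<in> \<A>))"

definition kappa :: "'a topology \<Rightarrow> 'a set set set" where
  "kappa X = {\<A>. compact_family X \<A>}"

definition base_of_topology_on :: "'b set set \<Rightarrow> 'b set \<Rightarrow> bool" where
  "base_of_topology_on \<B> S \<longleftrightarrow>
     (\<exists>T. topspace T = S \<and> openin T = arbitrary union_of (\<lambda>B. B \<in> \<B>))"

text \<open>The topology \<open>C\<^sub>\<alpha>(X,$)\<close>.  The carrier is inserted into the generating family, here and in
  \<open>C_real\<close> below, because \<open>topology_generated_by S\<close> has carrier \<open>\<Union>S\<close>.\<close>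

definition C_Sier :: "'a topology \<Rightarrow> 'a set set set \<Rightarrow> 'a set topology" where
  "C_Sier X \<alpha> = topology_generated_by (insert (opens X) \<alpha>)"

text \<open>Functions are made extensional so that elements of \<open>C(X,\<real>)\<close> are determined by their
  values on \<open>topspace X\<close>.\<close>

definition C_real_carrier :: "'a topology \<Rightarrow> ('a \<Rightarrow> real) set" where
  "C_real_carrier X = {f \<in> extensional (topspace X). continuous_map X euclideanreal f}"

definition sub_box :: "'a topology \<Rightarrow> 'a set set \<Rightarrow> real set \<Rightarrow> ('a \<Rightarrow> real) set" where
  "sub_box X \<A> U = {f \<in> C_real_carrier X. {x \<in> topspace X. f x \<in> U} \<in> \<A>}"

definition C_real :: "'a topology \<Rightarrow> 'a set set set \<Rightarrow> ('a \<Rightarrow> real) topology" where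
  "C_real X \<alpha> =
     topology_generated_by
       (insert (C_real_carrier X) {sub_box X \<A> U | \<A> U. \<A> \<in> \<alpha> \<and> open U})"

definition alpha_cover :: "'a topology \<Rightarrow> 'a set set set \<Rightarrow> 'a set set \<Rightarrow> bool" where
  "alpha_cover X \<alpha> \<P> \<longleftrightarrow>
     \<P> \<subseteq> opens X \<and> (\<forall>\<A>\<in>\<alpha>. topspace X \<in> \<A> \<longrightarrow> \<P> \<inter> \<A> \<noteq> {})"

definition meshes :: "'b filter \<Rightarrow> 'b filter \<Rightarrow> bool" where
  "meshes F G \<longleftrightarrow>
     (\<forall>A B. eventually (\<lambda>x. x \<in> A) F \<longrightarrow> eventually (\<lambda>x. x \<in> B) G \<longrightarrow> A \<inter> B \<noteq> {})"

text \<open>A filter is finer if it is smaller in the order of type \<open>filter\<close>, so the supremum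
  \<open>\<N>(y) \<or> \<H>\<close> is \<open>inf (nhdsin Y y) \<H>\<close>.  The type \<open>filter\<close> contains the improper filter
  \<open>bot\<close>, which is countably based and finer than every filter, hence the condition on \<open>\<L>\<close>; for \<open>\<H>\<close> it
  follows from meshing.\<close>

definition strongly_Frechet_at :: "'b topology \<Rightarrow> 'b \<Rightarrow> bool" where
  "strongly_Frechet_at Y y \<longleftrightarrow>
     y \<in> topspace Y \<and>
     (\<forall>\<H>. \<H> \<le> principal (topspace Y) \<and> countably_generated_filter \<H> \<and> meshes \<H> (nhdsin Y y) \<longrightarrow>
        (\<exists>\<L>. \<L> \<noteq> bot \<and> countably_generated_filter \<L> \<and> \<L> \<le> inf (nhdsin Y y) \<H>))"

lemma topspace_C_Sier:
  assumes "\<alpha> \<subseteq> kappa X"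
  shows "topspace (C_Sier X \<alpha>) = opens X"
  using assms by (auto simp: C_Sier_def kappa_def compact_family_def)

lemma topspace_C_real: "topspace (C_real X \<alpha>) = C_real_carrier X"
  by (auto simp: C_real_def sub_box_def)

end

theory Submission
  imports Defs
begin

text \<open>
  Each of the two function spaces matters only near one point, so the filters in the definition of
  a strongly Frechet point can be traded for sequences: with a local base at the point fixed, the
  property is a selection principle for decreasing sequences of sets that meet every basic
  neighbourhood (\<open>strongly_Frechet_at_iff_selection\<close>).  At the point \<open>X\<close> of
  \<open>C\<^sub>\<alpha>(X,$)\<close> the nonempty members of \<open>\<alpha>\<close> form such a base, and a set of open sets meeting
  all of them is exactly an \<open>\<alpha>\<close>-cover.  So the covering property is the strong Frechet property
  of \<open>C\<^sub>\<alpha>(X,$)\<close> at \<open>X\<close>, read through this base.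

  At the zero function of \<open>C\<^sub>\<alpha>(X,\<real>)\<close> the sets \<open>[\<A>, (-e,e)]\<close> form a base.  Two
  constructions translate between functions near zero and large open sets.  A decreasing sequence
  of sets \<open>H\<^sub>n\<close> of functions clustering at zero gives the \<open>\<alpha>\<close>-covers consisting of the
  open sets on which some \<open>f \<in> H\<^sub>n\<close> takes values in \<open>(-1/(n+1), 1/(n+1))\<close>; a selection
  converging to \<open>X\<close> then yields functions converging to zero, because members of \<open>\<alpha>\<close> are
  closed under open supersets (\<open>real_selection_from_Sier\<close>).  Conversely, an \<open>\<alpha>\<close>-cover \<open>\<P>\<close>
  gives the set of functions \<open>f\<close> such that \<open>f\<^sup>-\<^sup>1(-1,1)\<close> lies in a member of \<open>\<P>\<close>, and
  functions of this kind converging to zero give members of the covers converging to \<open>X\<close>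
  (\<open>Sier_selection_from_real\<close>).  That zero is in the closure of this set rests on complete
  regularity together with the finite subfamilies provided by compactness: inside an open
  \<open>U \<in> \<A>\<close> the sets where some function equal to 1 off \<open>U\<close> is small cover \<open>U\<close>, finitely
  many of them have a union in \<open>\<A>\<close>, and the minimum of the corresponding functions is in
  \<open>[\<A>, (-e,e)]\<close> (\<open>compact_family_Urysohn\<close>).
\<close>

section \<open>Strongly Frechet points and selections\<close>

definition decreasing_selection :: "'b set \<Rightarrow> 'b set set \<Rightarrow> bool" where
  "decreasing_selection S \<B> \<longleftrightarrow>
    (\<forall>A :: nat \<Rightarrow> 'b set. decseq A \<and> (\<forall>n. A n \<subseteq> S \<and> (\<forall>V\<in>\<B>. A n \<inter> V \<noteq> {})) \<longrightarrow>
      (\<exists>a. (\<forall>n. a n \<in> A n) \<and> (\<forall>V\<in>\<B>. \<forall>\<^sub>F n in sequentially. a n \<in> V)))"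

lemma decreasing_selectionI:
  assumes "\<And>A. decseq A \<Longrightarrow> (\<And>n. A n \<subseteq> S) \<Longrightarrow> (\<And>n V. V \<in> \<B> \<Longrightarrow> A n \<inter> V \<noteq> {}) \<Longrightarrow>
    \<exists>a. (\<forall>n. a n \<in> A n) \<and> (\<forall>V\<in>\<B>. \<forall>\<^sub>F n in sequentially. a n \<in> V)"
  shows "decreasing_selection S \<B>"
  unfolding decreasing_selection_def by (intro allI impI assms) simp_all

lemma decreasing_selectionE:
  assumes "decreasing_selection S \<B>" "decseq A" "\<And>n. A n \<subseteq> S"
    and "\<And>n V. V \<in> \<B> \<Longrightarrow> A n \<inter> V \<noteq> {}"
  obtains a where "\<And>n. a n \<in> A n" "\<And>V. V \<in> \<B> \<Longrightarrow> \<forall>\<^sub>F n in sequentially. a n \<in> V"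
proof -
  have "\<exists>a. (\<forall>n. a n \<in> A n) \<and> (\<forall>V\<in>\<B>. \<forall>\<^sub>F n in sequentially. a n \<in> V)"
    using assms unfolding decreasing_selection_def by simp
  then show thesis
    using that by blast
qed

text \<open>Decreasing sequences of nonempty sets are the bases of countably based proper filters.  A
  sequence obtained from the selection principle generates the finer filter; conversely, a finer
  filter meets each \<open>A n\<close> inside its own \<open>n\<close>-th basic set, and points chosen there converge.\<close>

lemma strongly_Frechet_at_iff_selection:
  fixes Y :: "'b topology"
  assumes y: "y \<in> topspace Y"
    and base: "\<And>V. V \<in> \<B> \<Longrightarrow> openin Y V \<and> y \<in> V"
    and local: "\<And>U. openin Y U \<Longrightarrow> y \<in> U \<Longrightarrow> \<exists>V\<in>\<B>. V \<subseteq> U"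
  shows "strongly_Frechet_at Y y \<longleftrightarrow> decreasing_selection (topspace Y) \<B>"
proof
  have ev_nhds: "eventually P (nhdsin Y y) \<longleftrightarrow> (\<exists>V\<in>\<B>. \<forall>x\<in>V. P x)" for P
    unfolding eventually_nhdsin using y base local by (meson subsetD)
  show "decreasing_selection (topspace Y) \<B>" if sF: "strongly_Frechet_at Y y"
  proof (rule decreasing_selectionI)
    fix A :: "nat \<Rightarrow> 'b set"
    assume A: "decseq A" "\<And>n. A n \<subseteq> topspace Y" "\<And>n V. V \<in> \<B> \<Longrightarrow> A n \<inter> V \<noteq> {}"
    define H where "H = (INF n. principal (A n))"
    have ev_H: "eventually P H \<longleftrightarrow> (\<exists>n. \<forall>x\<in>A n. P x)" for P
      unfolding H_def
    proof (subst eventually_INF_base)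
      fix m n :: nat
      have "A (max m n) \<subseteq> A m" "A (max m n) \<subseteq> A n"
        using antimonoD[OF A(1)] by simp_all
      then show "\<exists>k\<in>UNIV. principal (A k) \<le> inf (principal (A m)) (principal (A n))"
        by (intro bexI[of _ "max m n"]) auto
    qed (auto simp: eventually_principal)
    have "H \<le> principal (topspace Y)"
      using A(2) by (auto simp: le_principal ev_H)
    moreover have "countably_generated_filter H"
      unfolding countably_generated_filter_def H_def by blast
    moreover have "meshes H (nhdsin Y y)"
      unfolding meshes_def ev_H ev_nhds using A(3) by blast
    ultimately obtain L where L: "L \<noteq> bot" "countably_generated_filter L" "L \<le> inf (nhdsin Y y) H"
      using sF unfolding strongly_Frechet_at_def by blast
    then have L_nhds: "L \<le> nhdsin Y y" and L_H: "L \<le> H"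
      by simp_all
    obtain B :: "nat \<Rightarrow> 'b set" where B: "antimono B"
        "\<And>P. eventually P L \<longleftrightarrow> (\<exists>i. \<forall>x\<in>B i. P x)"
      using countably_generated_filter_has_antimono_basis[OF L(2)] by metis
    have "\<exists>x. x \<in> A n \<inter> B n" for n
    proof -
      have "eventually (\<lambda>x. x \<in> A n) L"
        by (rule filter_leD[OF L_H]) (auto simp: ev_H)
      moreover have "eventually (\<lambda>x. x \<in> B n) L"
        unfolding B(2) by blast
      ultimately have "eventually (\<lambda>x. x \<in> A n \<inter> B n) L"
        by (simp add: eventually_conj)
      then show ?thesis
        using L(1) eventually_happens' by blast
    qed
    then obtain a where a: "\<And>n. a n \<in> A n \<inter> B n"
      by metis
    have "\<forall>\<^sub>F n in sequentially. a n \<in> V" if "V \<in> \<B>" for V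
    proof -
      have "eventually (\<lambda>x. x \<in> V) L"
        by (rule filter_leD[OF L_nhds]) (use that in \<open>auto simp: ev_nhds\<close>)
      then obtain i where "B i \<subseteq> V"
        unfolding B(2) by blast
      then have "a n \<in> V" if "n \<ge> i" for n
        using a[of n] antimonoD[OF B(1) that] by blast
      then show ?thesis
        unfolding eventually_sequentially by blast
    qed
    with a show "\<exists>a. (\<forall>n. a n \<in> A n) \<and> (\<forall>V\<in>\<B>. \<forall>\<^sub>F n in sequentially. a n \<in> V)"
      by blast
  qed
  show "strongly_Frechet_at Y y" if sel: "decreasing_selection (topspace Y) \<B>"
    unfolding strongly_Frechet_at_def
  proof (intro conjI allI impI)
    fix H :: "'b filter"
    assume H: "H \<le> principal (topspace Y) \<and> countably_generated_filter H \<and> meshes H (nhdsin Y y)"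
    obtain B :: "nat \<Rightarrow> 'b set" where B: "antimono B"
        "\<And>P. eventually P H \<longleftrightarrow> (\<exists>i. \<forall>x\<in>B i. P x)"
      using countably_generated_filter_has_antimono_basis[of H] H by metis
    define A where "A n = B n \<inter> topspace Y" for n
    have "decseq A"
      using B(1) by (auto simp: A_def monotone_def)
    moreover have "A n \<inter> V \<noteq> {}" if "V \<in> \<B>" for n V
    proof -
      have "eventually (\<lambda>x. x \<in> A n) H"
        unfolding A_def Int_iff eventually_conj_iff
        using H unfolding le_principal B(2) by blast
      moreover have "eventually (\<lambda>x. x \<in> V) (nhdsin Y y)"
        unfolding ev_nhds using that by blast
      ultimately show ?thesis
        using H unfolding meshes_def by blast
    qed
    moreover have "A n \<subseteq> topspace Y" for n
      by (simp add: A_def)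
    ultimately obtain a where
      a: "\<And>n. a n \<in> A n" "\<And>V. V \<in> \<B> \<Longrightarrow> \<forall>\<^sub>F n in sequentially. a n \<in> V"
      using decreasing_selectionE[OF sel, of A] by metis
    have "filtermap a sequentially \<le> nhdsin Y y"
      unfolding le_filter_def eventually_filtermap ev_nhds
      using a(2) by (metis (mono_tags, lifting) eventually_mono)
    moreover have "filtermap a sequentially \<le> H"
      unfolding le_filter_def eventually_filtermap B(2) eventually_sequentially
      using a(1) antimonoD[OF B(1)] unfolding A_def by blast
    moreover have "countably_generated_filter (filtermap a sequentially)"
    proof -
      have "filtermap a sequentially = (INF n::nat. principal (a ` {n..}))"
      proof (rule filter_eqI)
        fix P
        show "eventually P (filtermap a sequentially) \<longleftrightarrow> eventually P (INF n::nat. principal (a ` {n..}))"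
        proof (subst eventually_INF_base)
          fix m n :: nat
          show "\<exists>k\<in>UNIV. principal (a ` {k..}) \<le> inf (principal (a ` {m..})) (principal (a ` {n..}))"
            by (intro bexI[of _ "max m n"]) auto
        qed (auto simp: eventually_principal eventually_filtermap eventually_sequentially)
      qed
      then show ?thesis
        unfolding countably_generated_filter_def by (rule exI[of _ "\<lambda>n. a ` {n..}"])
    qed
    ultimately show "\<exists>L. L \<noteq> bot \<and> countably_generated_filter L \<and> L \<le> inf (nhdsin Y y) H"
      by (intro exI[of _ "filtermap a sequentially"]) (auto simp: filtermap_bot_iff)
  qed (fact y)
qed

section \<open>Local bases in the two function spaces\<close>

lemma topology_generated_by_local_base:
  assumes "openin (topology_generated_by \<S>) U" and "y \<in> U"
    and gen: "\<And>S. S \<in> \<S> \<Longrightarrow> y \<in> S \<Longrightarrow> \<exists>V\<in>\<B>. V \<subseteq> S"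
    and dir: "\<And>V W. V \<in> \<B> \<Longrightarrow> W \<in> \<B> \<Longrightarrow> \<exists>Z\<in>\<B>. Z \<subseteq> V \<inter> W"
  shows "\<exists>V\<in>\<B>. V \<subseteq> U"
proof -
  have "generate_topology_on \<S> U"
    using assms(1) by (rule openin_topology_generated_by)
  then show ?thesis
    using \<open>y \<in> U\<close>
  proof induction
    case (Int a b)
    then obtain V W where "V \<in> \<B>" "V \<subseteq> a" "W \<in> \<B>" "W \<subseteq> b"
      by blast
    then show ?case
      using dir[of V W] by blast
  next
    case (UN K)
    then obtain k where "k \<in> K" "y \<in> k"
      by blast
    with UN.IH show ?case
      by (meson Union_upper order_trans)
  next
    case (Basis S)
    then show ?case
      by (rule gen)
  qed simp
qed

lemma base_of_topology_on_Int:
  assumes "base_of_topology_on \<B> S" "V \<in> \<B>" "W \<in> \<B>" "y \<in> V \<inter> W"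
  shows "\<exists>Z\<in>\<B>. y \<in> Z \<and> Z \<subseteq> V \<inter> W"
proof -
  obtain T where T: "openin T = arbitrary union_of (\<lambda>B. B \<in> \<B>)"
    using assms(1) unfolding base_of_topology_on_def by blast
  have "openin T V" "openin T W"
    using assms(2,3) by (auto simp: T intro: arbitrary_union_of_inc)
  then have "(arbitrary union_of (\<lambda>B. B \<in> \<B>)) (V \<inter> W)"
    using openin_Int T by metis
  then show ?thesis
    using assms(4) unfolding union_of_def by blast
qed

lemma base_of_topology_on_covers:
  assumes "base_of_topology_on \<B> S" "y \<in> S"
  shows "\<exists>Z\<in>\<B>. y \<in> Z"
proof -
  obtain T where T: "topspace T = S" "openin T = arbitrary union_of (\<lambda>B. B \<in> \<B>)"
    using assms(1) unfolding base_of_topology_on_def by blast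
  then have "(arbitrary union_of (\<lambda>B. B \<in> \<B>)) S"
    using openin_topspace by metis
  then show ?thesis
    using assms(2) unfolding union_of_def by blast
qed

lemma compact_family_mono:
  assumes "compact_family X \<A>" "U \<in> \<A>" "U \<subseteq> V" "openin X V"
  shows "V \<in> \<A>"
  using assms unfolding compact_family_def nbhd_families_def nbhd_family_def opens_def by blast

lemma topspace_in_compact_family:
  assumes "compact_family X \<A>" "\<A> \<noteq> {}"
  shows "topspace X \<in> \<A>"
proof -
  obtain U where "U \<in> \<A>" "openin X U"
    using assms unfolding compact_family_def opens_def by blast
  then show ?thesis
    using compact_family_mono[OF assms(1)] openin_subset by blast
qed

text \<open>All nonempty members of \<open>\<alpha>\<close> contain \<open>X\<close>, so the base property, applied at the
  point \<open>X\<close>, refines the intersection of two of them by a third.\<close>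

lemma C_Sier_local_base:
  assumes "\<alpha> \<subseteq> kappa X" "base_of_topology_on \<alpha> (opens X)"
  shows "\<A> \<in> \<alpha> - {{}} \<Longrightarrow> openin (C_Sier X \<alpha>) \<A> \<and> topspace X \<in> \<A>"
    and "openin (C_Sier X \<alpha>) \<U> \<Longrightarrow> topspace X \<in> \<U> \<Longrightarrow> \<exists>\<A>\<in>\<alpha> - {{}}. \<A> \<subseteq> \<U>"
proof -
  have top: "topspace X \<in> \<A>" if "\<A> \<in> \<alpha> - {{}}" for \<A>
    using that assms(1) topspace_in_compact_family by (auto simp: kappa_def)
  show "openin (C_Sier X \<alpha>) \<A> \<and> topspace X \<in> \<A>" if "\<A> \<in> \<alpha> - {{}}"
    using that top unfolding C_Sier_def by (auto intro: topology_generated_by_Basis)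
  assume U: "openin (C_Sier X \<alpha>) \<U>" "topspace X \<in> \<U>"
  show "\<exists>\<A>\<in>\<alpha> - {{}}. \<A> \<subseteq> \<U>"
  proof (rule topology_generated_by_local_base)
    show "openin (topology_generated_by (insert (opens X) \<alpha>)) \<U>"
      using U(1) by (simp add: C_Sier_def)
    show "\<exists>\<A>\<in>\<alpha> - {{}}. \<A> \<subseteq> S" if S: "S \<in> insert (opens X) \<alpha>" "topspace X \<in> S" for S
    proof (cases "S \<in> \<alpha>")
      case False
      then have "S = opens X"
        using S(1) by blast
      then obtain \<A> where A: "\<A> \<in> \<alpha>" "topspace X \<in> \<A>"
        using base_of_topology_on_covers[OF assms(2)] S(2) by blast
      then have "\<A> \<subseteq> S"
        using assms(1) \<open>S = opens X\<close> unfolding kappa_def compact_family_def by blast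
      then show ?thesis
        using A by blast
    qed (use S in blast)
    show "\<exists>Z\<in>\<alpha> - {{}}. Z \<subseteq> V \<inter> W" if VW: "V \<in> \<alpha> - {{}}" "W \<in> \<alpha> - {{}}" for V W
    proof -
      obtain Z where "Z \<in> \<alpha>" "topspace X \<in> Z" "Z \<subseteq> V \<inter> W"
        using base_of_topology_on_Int[OF assms(2), of V W "topspace X"] VW top by blast
      then show ?thesis
        by blast
    qed
  qed (fact U(2))
qed

lemma openin_preimage:
  assumes "f \<in> C_real_carrier X" "open U"
  shows "openin X {x \<in> topspace X. f x \<in> U}"
  using assms openin_continuous_map_preimage[of X euclideanreal f U]
  by (simp add: C_real_carrier_def)

lemma zero_in_C_real_carrier: "(\<lambda>x\<in>topspace X. 0) \<in> C_real_carrier X"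
  by (auto simp: C_real_carrier_def intro: continuous_map_eq[of X euclideanreal "\<lambda>x. 0"])

definition zero_boxes :: "'a topology \<Rightarrow> 'a set set set \<Rightarrow> ('a \<Rightarrow> real) set set" where
  "zero_boxes X \<alpha> = {sub_box X \<A> {-e<..<e} | \<A> e. \<A> \<in> \<alpha> \<and> \<A> \<noteq> {} \<and> 0 < e}"

lemma zero_in_sub_box:
  assumes "compact_family X \<A>" "\<A> \<noteq> {}" "0 \<in> U"
  shows "(\<lambda>x\<in>topspace X. 0) \<in> sub_box X \<A> U"
proof -
  have "{x \<in> topspace X. (\<lambda>x\<in>topspace X. 0) x \<in> U} = topspace X"
    using assms(3) by auto
  then show ?thesis
    using zero_in_C_real_carrier topspace_in_compact_family[OF assms(1,2)]
    unfolding sub_box_def by simp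
qed

lemma sub_box_mono:
  assumes "compact_family X \<B>" "\<A> \<subseteq> \<B>" "U \<subseteq> V" "open V"
  shows "sub_box X \<A> U \<subseteq> sub_box X \<B> V"
proof
  fix f
  assume f: "f \<in> sub_box X \<A> U"
  then have "openin X {x \<in> topspace X. f x \<in> V}"
    using openin_preimage[OF _ assms(4)] by (auto simp: sub_box_def)
  moreover have "{x \<in> topspace X. f x \<in> U} \<in> \<B>"
    using f assms(2) by (auto simp: sub_box_def)
  ultimately have "{x \<in> topspace X. f x \<in> V} \<in> \<B>"
    using assms(3) by (elim compact_family_mono[OF assms(1), rotated 2]) auto
  then show "f \<in> sub_box X \<B> V"
    using f by (simp add: sub_box_def)
qed

text \<open>A subbasic neighbourhood \<open>[\<A>, U]\<close> of zero either has \<open>0 \<in> U\<close>, and then contains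
  \<open>[\<A>, (-e,e)]\<close> for an interval inside \<open>U\<close>, or it is the whole space.  Intersections are
  handled by refining the two families within \<open>\<alpha>\<close> and taking the smaller interval.\<close>

lemma C_real_local_base:
  assumes "\<alpha> \<subseteq> kappa X" "base_of_topology_on \<alpha> (opens X)"
  defines "z \<equiv> (\<lambda>x\<in>topspace X. 0 :: real)"
  shows "V \<in> zero_boxes X \<alpha> \<Longrightarrow> openin (C_real X \<alpha>) V \<and> z \<in> V"
    and "openin (C_real X \<alpha>) U \<Longrightarrow> z \<in> U \<Longrightarrow> \<exists>V\<in>zero_boxes X \<alpha>. V \<subseteq> U"
proof -
  have cpt: "compact_family X \<A>" if "\<A> \<in> \<alpha>" for \<A>
    using that assms(1) by (auto simp: kappa_def)
  show "openin (C_real X \<alpha>) V \<and> z \<in> V" if V: "V \<in> zero_boxes X \<alpha>"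
  proof -
    obtain \<A> e where A: "V = sub_box X \<A> {-e<..<e}" "\<A> \<in> \<alpha>" "\<A> \<noteq> {}" "0 < e"
      using V unfolding zero_boxes_def by blast
    then have "V \<in> insert (C_real_carrier X) {sub_box X \<A> U | \<A> U. \<A> \<in> \<alpha> \<and> open U}"
      using open_greaterThanLessThan by blast
    then have "openin (C_real X \<alpha>) V"
      unfolding C_real_def by (rule topology_generated_by_Basis)
    then show ?thesis
      unfolding z_def using zero_in_sub_box[OF cpt] A by simp
  qed
  assume U: "openin (C_real X \<alpha>) U" "z \<in> U"
  show "\<exists>V\<in>zero_boxes X \<alpha>. V \<subseteq> U"
  proof (rule topology_generated_by_local_base)
    show "openin (topology_generated_by
        (insert (C_real_carrier X) {sub_box X \<A> U | \<A> U. \<A> \<in> \<alpha> \<and> open U})) U"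
      using U(1) by (simp add: C_real_def)
    fix S
    assume S: "S \<in> insert (C_real_carrier X) {sub_box X \<A> U | \<A> U. \<A> \<in> \<alpha> \<and> open U}" "z \<in> S"
    obtain \<A>0 where \<A>0: "\<A>0 \<in> \<alpha>" "topspace X \<in> \<A>0"
      using base_of_topology_on_covers[OF assms(2), of "topspace X"] by (auto simp: opens_def)
    have whole: "\<exists>V\<in>zero_boxes X \<alpha>. V \<subseteq> S" if "C_real_carrier X \<subseteq> S"
    proof (rule bexI)
      show "sub_box X \<A>0 {-1<..<1} \<in> zero_boxes X \<alpha>"
        unfolding zero_boxes_def using \<A>0 zero_less_one by blast
      show "sub_box X \<A>0 {-1<..<1} \<subseteq> S"
        using that by (auto simp: sub_box_def)
    qed
    show "\<exists>V\<in>zero_boxes X \<alpha>. V \<subseteq> S"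
    proof (cases "S = C_real_carrier X")
      case False
      then obtain \<A> W where W: "S = sub_box X \<A> W" "\<A> \<in> \<alpha>" "open W"
        using S(1) by blast
      show ?thesis
      proof (cases "0 \<in> W")
        case True
        then obtain e where "0 < e" "ball 0 e \<subseteq> W"
          using W(3) open_contains_ball by blast
        then have "{-e<..<e} \<subseteq> W"
          by (simp add: ball_eq_greaterThanLessThan)
        then have "sub_box X \<A> {-e<..<e} \<subseteq> S"
          using sub_box_mono[OF cpt] W by blast
        moreover have "\<A> \<noteq> {}"
          using S(2) W(1) by (auto simp: sub_box_def)
        ultimately show ?thesis
          unfolding zero_boxes_def using W(2) \<open>0 < e\<close> by blast
      next
        \<comment> \<open>The preimage of \<open>W\<close> under the zero function is empty, so \<open>\<A>\<close> contains all open
          sets and imposes no condition at all.\<close>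
        case False
        then have "{x \<in> topspace X. z x \<in> W} = {}"
          by (auto simp: z_def)
        moreover have "{x \<in> topspace X. z x \<in> W} \<in> \<A>"
          using S(2) unfolding W(1) sub_box_def by blast
        ultimately have "{} \<in> \<A>"
          by (simp only:)
        then have "C_real_carrier X \<subseteq> S"
          using compact_family_mono[OF cpt[OF W(2)], of "{}"] openin_preimage[OF _ W(3)]
          unfolding W(1) sub_box_def by blast
        then show ?thesis
          by (rule whole)
      qed
    qed (use whole in blast)
  next
    fix V W
    assume "V \<in> zero_boxes X \<alpha>" "W \<in> zero_boxes X \<alpha>"
    then obtain \<A> d \<B> e where
      V: "V = sub_box X \<A> {-d<..<d}" "\<A> \<in> \<alpha>" "\<A> \<noteq> {}" "0 < d" and
      W: "W = sub_box X \<B> {-e<..<e}" "\<B> \<in> \<alpha>" "\<B> \<noteq> {}" "0 < e"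
      unfolding zero_boxes_def by blast
    obtain \<C> where C: "\<C> \<in> \<alpha>" "\<C> \<noteq> {}" "\<C> \<subseteq> \<A>" "\<C> \<subseteq> \<B>"
      using base_of_topology_on_Int[OF assms(2), of \<A> \<B> "topspace X"] V W cpt
        topspace_in_compact_family by blast
    have "sub_box X \<C> {-min d e<..<min d e} \<subseteq> V" "sub_box X \<C> {-min d e<..<min d e} \<subseteq> W"
      unfolding V(1) W(1) using C V(2) W(2) cpt by (intro sub_box_mono; auto)+
    moreover have "sub_box X \<C> {-min d e<..<min d e} \<in> zero_boxes X \<alpha>"
      unfolding zero_boxes_def using C V(4) W(4) min_less_iff_conj by blast
    ultimately show "\<exists>Z\<in>zero_boxes X \<alpha>. Z \<subseteq> V \<inter> W"
      by blast
  qed (fact U(2))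
qed

section \<open>Urysohn functions for compact families\<close>

text \<open>The sublevel sets of the pointwise Urysohn functions cover \<open>U\<close>, by compactness finitely
  many of them have a union in the family, and this union is a sublevel set of the minimum of the
  finitely many functions.\<close>

lemma compact_family_Urysohn:
  assumes X: "completely_regular_space X" and A: "compact_family X \<A>" and U: "U \<in> \<A>"
    and e: "0 < (e :: real)"
  obtains f where "f \<in> sub_box X \<A> {-e<..<e}" and "\<And>x. x \<in> topspace X - U \<Longrightarrow> f x = 1"
proof -
  \<comment> \<open>Functions with values in \<open>[0,1]\<close> that are 1 off \<open>U\<close> are closed under minima; the
    constant 1 is the minimum of no functions.\<close>
  define K where "K = {g. continuous_map X euclideanreal g \<and>
    (\<forall>x\<in>topspace X. 0 \<le> g x \<and> g x \<le> 1) \<and> (\<forall>x\<in>topspace X - U. g x = 1)}"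
  \<comment> \<open>The bound is at most 1 so that the sublevel set of the constant 1 is empty.\<close>
  define c where "c = min e 1"
  have c: "0 < c" "c \<le> 1" "c \<le> e"
    using e by (auto simp: c_def)
  define Q where "Q = {{x \<in> topspace X. g x < c} | g. g \<in> K}"
  have U_open: "openin X U"
    using A U by (auto simp: compact_family_def opens_def)
  have Q_opens: "Q \<subseteq> opens X"
  proof
    fix q
    assume "q \<in> Q"
    then obtain g where g: "q = {x \<in> topspace X. g x \<in> {..<c}}" "continuous_map X euclideanreal g"
      by (auto simp: Q_def K_def)
    then show "q \<in> opens X"
      using openin_continuous_map_preimage[OF g(2), of "{..<c}"] by (simp add: opens_def)
  qed
  have "U \<subseteq> \<Union>Q"
  proof
    fix x
    assume x: "x \<in> U"
    have "closedin X (topspace X - U)" "x \<in> topspace X - (topspace X - U)"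
      using U_open openin_subset[OF U_open] x by auto
    then obtain g where g: "continuous_map X (top_of_set {0..1 :: real}) g" "g x = 0"
        "g ` (topspace X - U) \<subseteq> {1}"
      using X[unfolded completely_regular_space_def, rule_format, of "topspace X - U" x] by blast
    then have "g \<in> K"
      unfolding K_def by (auto simp: continuous_map_in_subtopology image_subset_iff Pi_iff)
    then have "{x \<in> topspace X. g x < c} \<in> Q"
      unfolding Q_def by blast
    moreover have "x \<in> {x \<in> topspace X. g x < c}"
      using x openin_subset[OF U_open] g(2) c(1) by auto
    ultimately show "x \<in> \<Union>Q"
      by blast
  qed
  moreover have "openin X (\<Union>Q)"
    using Q_opens by (intro openin_Union) (auto simp: opens_def)
  ultimately have "\<Union>Q \<in> \<A>"
    using compact_family_mono[OF A U] by blast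
  then obtain S where S: "finite S" "S \<subseteq> Q" "\<Union>S \<in> \<A>"
    using A Q_opens unfolding compact_family_def by blast
  have "\<exists>g\<in>K. {x \<in> topspace X. g x < c} = \<Union>S"
    using S(1,2)
  proof (induction S)
    case empty
    show ?case
      using c(2) by (intro bexI[of _ "\<lambda>_. 1"]) (auto simp: K_def)
  next
    case (insert q S)
    then have "\<exists>g\<in>K. {x \<in> topspace X. g x < c} = \<Union>S" and "q \<in> Q"
      by simp_all
    then obtain g h where g: "g \<in> K" "{x \<in> topspace X. g x < c} = \<Union>S"
      and h: "h \<in> K" "q = {x \<in> topspace X. h x < c}"
      unfolding Q_def by blast
    have "continuous_map X euclideanreal (\<lambda>x. min (g x) (h x))"
      using g(1) h(1) by (intro continuous_map_real_min) (simp_all add: K_def)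
    then have "(\<lambda>x. min (g x) (h x)) \<in> K"
      using g(1) h(1) by (simp add: K_def min_le_iff_disj)
    moreover have "{x \<in> topspace X. min (g x) (h x) < c} = \<Union>(insert q S)"
      unfolding Union_insert h(2) g(2)[symmetric] min_less_iff_disj by blast
    ultimately show ?case
      by (intro bexI[of _ "\<lambda>x. min (g x) (h x)"])
  qed
  then obtain g where g: "g \<in> K" "{x \<in> topspace X. g x < c} = \<Union>S"
    by (elim bexE) (rule that)
  define f where "f = restrict g (topspace X)"
  have fC: "f \<in> C_real_carrier X"
    using g(1) continuous_map_eq[of X euclideanreal g f] by (simp add: C_real_carrier_def f_def K_def)
  have "\<Union>S \<subseteq> {x \<in> topspace X. f x \<in> {-e<..<e}}"
    unfolding g(2)[symmetric]
  proof
    fix x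
    assume "x \<in> {x \<in> topspace X. g x < c}"
    then have "x \<in> topspace X" "0 \<le> f x" "f x < c"
      using g(1) by (simp_all add: f_def K_def)
    then show "x \<in> {x \<in> topspace X. f x \<in> {-e<..<e}}"
      using c e by simp
  qed
  then have "{x \<in> topspace X. f x \<in> {-e<..<e}} \<in> \<A>"
    using compact_family_mono[OF A S(3)] openin_preimage[OF fC, of "{-e<..<e}"] by simp
  then have "f \<in> sub_box X \<A> {-e<..<e}"
    using fC by (simp add: sub_box_def)
  moreover have "f x = 1" if "x \<in> topspace X - U" for x
    using that g(1) by (simp add: f_def K_def)
  ultimately show thesis
    by (rule that)
qed

section \<open>Transfer of selections\<close>

text \<open>The sets \<open>H n\<close> in the proof bound the region where \<open>\<bar>f\<bar> < 1\<close> by a member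
  of \<open>\<P> n\<close>.  Once a selected function lies in \<open>[\<A>, (-1,1)]\<close>, the member of \<open>\<P> n\<close>
  bounding it contains an element of \<open>\<A>\<close> and therefore belongs to \<open>\<A>\<close>.\<close>

lemma Sier_selection_from_real:
  assumes X: "completely_regular_space X" and \<alpha>: "\<alpha> \<subseteq> kappa X"
    and real: "decreasing_selection (C_real_carrier X) (zero_boxes X \<alpha>)"
  shows "decreasing_selection (opens X) (\<alpha> - {{}})"
proof (rule decreasing_selectionI)
  fix \<P>
  assume P: "decseq \<P>" "\<And>n. \<P> n \<subseteq> opens X" "\<And>n \<A>. \<A> \<in> \<alpha> - {{}} \<Longrightarrow> \<P> n \<inter> \<A> \<noteq> {}"
  have cpt: "compact_family X \<A>" if "\<A> \<in> \<alpha>" for \<A>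
    using that \<alpha> by (auto simp: kappa_def)
  define H where "H n =
    {f \<in> C_real_carrier X. \<exists>U\<in>\<P> n. {x \<in> topspace X. f x \<in> {-1<..<1}} \<subseteq> U}" for n
  have "decseq H"
    using P(1) unfolding decseq_def H_def by blast
  moreover have "H n \<subseteq> C_real_carrier X" for n
    by (auto simp: H_def)
  moreover have "H n \<inter> V \<noteq> {}" if V: "V \<in> zero_boxes X \<alpha>" for n V
  proof -
    obtain \<A> e where A: "V = sub_box X \<A> {-e<..<e}" "\<A> \<in> \<alpha>" "\<A> \<noteq> {}" "0 < e"
      using V unfolding zero_boxes_def by blast
    then obtain U where U: "U \<in> \<P> n" "U \<in> \<A>"
      using P(3)[of \<A> n] by blast
    obtain f where f: "f \<in> V" "\<And>x. x \<in> topspace X - U \<Longrightarrow> f x = 1"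
      using compact_family_Urysohn[OF X cpt[OF A(2)] U(2) A(4)] A(1) by blast
    have "{x \<in> topspace X. f x \<in> {-1<..<1}} \<subseteq> U"
      using f(2) by force
    then have "f \<in> H n"
      using f(1) U(1) by (auto simp: H_def A(1) sub_box_def)
    then show ?thesis
      using f(1) by blast
  qed
  ultimately obtain h where h: "\<And>n. h n \<in> H n"
      "\<And>V. V \<in> zero_boxes X \<alpha> \<Longrightarrow> \<forall>\<^sub>F n in sequentially. h n \<in> V"
    using decreasing_selectionE[OF real, of H] by metis
  then obtain P where P': "\<And>n. P n \<in> \<P> n"
      "\<And>n. {x \<in> topspace X. h n x \<in> {-1<..<1}} \<subseteq> P n"
    unfolding H_def by simp metis
  have "\<forall>\<^sub>F n in sequentially. P n \<in> \<A>" if A: "\<A> \<in> \<alpha> - {{}}" for \<A>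
  proof -
    have "sub_box X \<A> {-1<..<1} \<in> zero_boxes X \<alpha>"
      unfolding zero_boxes_def using A zero_less_one by blast
    then have "\<forall>\<^sub>F n in sequentially. h n \<in> sub_box X \<A> {-1<..<1}"
      by (rule h(2))
    then show ?thesis
    proof (rule eventually_mono)
      fix n
      assume "h n \<in> sub_box X \<A> {-1<..<1}"
      then have "{x \<in> topspace X. h n x \<in> {-1<..<1}} \<in> \<A>"
        by (simp add: sub_box_def)
      then show "P n \<in> \<A>"
        using A P'[of n] P(2)[of n]
        by (intro compact_family_mono[OF cpt[of \<A>], of _ "P n"]) (auto simp: opens_def)
    qed
  qed
  with P'(1) show "\<exists>P. (\<forall>n. P n \<in> \<P> n) \<and> (\<forall>\<A>\<in>\<alpha> - {{}}. \<forall>\<^sub>F n in sequentially. P n \<in> \<A>)"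
    by blast
qed

text \<open>The preimages \<open>f\<^sup>-\<^sup>1(-1/(n+1), 1/(n+1))\<close> with \<open>f \<in> H n\<close> need not form a
  decreasing sequence of covers.  Adding all their open subsets repairs this, since for a fixed
  \<open>f\<close> the preimages shrink, and it costs nothing: when a subset of a preimage belongs to \<open>\<A>\<close>,
  so does the preimage.\<close>

lemma real_selection_from_Sier:
  assumes \<alpha>: "\<alpha> \<subseteq> kappa X"
    and Sier: "decreasing_selection (opens X) (\<alpha> - {{}})"
  shows "decreasing_selection (C_real_carrier X) (zero_boxes X \<alpha>)"
proof (rule decreasing_selectionI)
  fix H
  assume H: "decseq H" "\<And>n. H n \<subseteq> C_real_carrier X"
    "\<And>n V. V \<in> zero_boxes X \<alpha> \<Longrightarrow> H n \<inter> V \<noteq> {}"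
  have cpt: "compact_family X \<A>" if "\<A> \<in> \<alpha>" for \<A>
    using that \<alpha> by (auto simp: kappa_def)
  define I :: "nat \<Rightarrow> real set" where "I n = {- inverse (Suc n)<..<inverse (Suc n)}" for n
  have I_mono: "I n \<subseteq> I m" if "m \<le> n" for m n
  proof -
    have "inverse (real (Suc n)) \<le> inverse (real (Suc m))"
      using that by (intro le_imp_inverse_le) auto
    then show ?thesis
      unfolding I_def by (intro greaterThanLessThan_subseteq_greaterThanLessThan[THEN iffD2]) linarith
  qed
  define \<P> where
    "\<P> n = {U \<in> opens X. \<exists>f\<in>H n. U \<subseteq> {x \<in> topspace X. f x \<in> I n}}" for n
  have "decseq \<P>"
    using H(1) I_mono unfolding decseq_def \<P>_def by blast
  moreover have "\<P> n \<subseteq> opens X" for n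
    by (auto simp: \<P>_def)
  moreover have "\<P> n \<inter> \<A> \<noteq> {}" if A: "\<A> \<in> \<alpha> - {{}}" for n \<A>
  proof -
    have "0 < inverse (real (Suc n))"
      by simp
    then have "sub_box X \<A> (I n) \<in> zero_boxes X \<alpha>"
      unfolding zero_boxes_def I_def using A by blast
    then obtain f where f: "f \<in> H n" "f \<in> sub_box X \<A> (I n)"
      using H(3)[of _ n] by blast
    then have "{x \<in> topspace X. f x \<in> I n} \<in> \<P> n \<inter> \<A>"
      using cpt[of \<A>] A unfolding \<P>_def sub_box_def compact_family_def by blast
    then show ?thesis
      by blast
  qed
  ultimately obtain P where P: "\<And>n. P n \<in> \<P> n"
      "\<And>\<A>. \<A> \<in> \<alpha> - {{}} \<Longrightarrow> \<forall>\<^sub>F n in sequentially. P n \<in> \<A>"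
    using decreasing_selectionE[OF Sier, of \<P>] by metis
  obtain h where h: "\<And>n. h n \<in> H n" "\<And>n. P n \<subseteq> {x \<in> topspace X. h n x \<in> I n}"
    using P(1) unfolding \<P>_def by simp metis
  have "\<forall>\<^sub>F n in sequentially. h n \<in> V" if V: "V \<in> zero_boxes X \<alpha>" for V
  proof -
    obtain \<A> e where A: "V = sub_box X \<A> {-e<..<e}" "\<A> \<in> \<alpha>" "\<A> \<noteq> {}" "0 < e"
      using V unfolding zero_boxes_def by blast
    obtain N where N: "inverse (real (Suc N)) < e"
      using reals_Archimedean[OF A(4)] by blast
    have "\<forall>\<^sub>F n in sequentially. P n \<in> \<A>"
      using P(2) A(2,3) by blast
    then show ?thesis
      using eventually_ge_at_top[of N]
    proof eventually_elim
      fix n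
      assume n: "P n \<in> \<A>" "N \<le> n"
      have hC: "h n \<in> C_real_carrier X"
        using h(1) H(2) by blast
      have "I n \<subseteq> {-e<..<e}"
        using I_mono[OF n(2)] N by (auto simp: I_def)
      then have "P n \<subseteq> {x \<in> topspace X. h n x \<in> {-e<..<e}}"
        using h(2)[of n] by blast
      then have "{x \<in> topspace X. h n x \<in> {-e<..<e}} \<in> \<A>"
        using compact_family_mono[OF cpt[OF A(2)] n(1)] openin_preimage[OF hC, of "{-e<..<e}"]
        by simp
      then show "h n \<in> V"
        using hC by (simp add: A(1) sub_box_def)
    qed
  qed
  with h(1) show "\<exists>h. (\<forall>n. h n \<in> H n) \<and> (\<forall>V\<in>zero_boxes X \<alpha>. \<forall>\<^sub>F n in sequentially. h n \<in> V)"
    by blast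
qed

theorem theorem11p1:
  fixes X :: "'a topology" and \<alpha> :: "'a set set set"
  assumes "completely_regular_space X"
    and "p_families X \<subseteq> \<alpha>"
    and "\<alpha> \<subseteq> kappa X"
    and "base_of_topology_on \<alpha> (opens X)"
  shows
    "(strongly_Frechet_at (C_real X \<alpha>) (\<lambda>x\<in>topspace X. 0) \<longleftrightarrow>
        strongly_Frechet_at (C_Sier X \<alpha>) (topspace X)) \<and>
     (strongly_Frechet_at (C_Sier X \<alpha>) (topspace X) \<longleftrightarrow>
        (\<forall>\<P> :: nat \<Rightarrow> 'a set set.
           decseq \<P> \<and> (\<forall>n. alpha_cover X \<alpha> (\<P> n)) \<longrightarrow>
           (\<exists>P :: nat \<Rightarrow> 'a set.
              (\<forall>n. P n \<in> \<P> n) \<and>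
              (\<forall>\<A>\<in>\<alpha>. \<A> \<noteq> {} \<longrightarrow> finite {n. P n \<notin> \<A>}))))"
proof -
  note \<alpha> = assms(3,4)
  have "strongly_Frechet_at (C_real X \<alpha>) (\<lambda>x\<in>topspace X. 0) \<longleftrightarrow>
    decreasing_selection (topspace (C_real X \<alpha>)) (zero_boxes X \<alpha>)"
    by (rule strongly_Frechet_at_iff_selection[OF _ C_real_local_base[OF \<alpha>]])
      (simp_all add: topspace_C_real zero_in_C_real_carrier)
  then have real: "strongly_Frechet_at (C_real X \<alpha>) (\<lambda>x\<in>topspace X. 0) \<longleftrightarrow>
    decreasing_selection (C_real_carrier X) (zero_boxes X \<alpha>)"
    by (simp only: topspace_C_real)
  have "strongly_Frechet_at (C_Sier X \<alpha>) (topspace X) \<longleftrightarrow>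
    decreasing_selection (topspace (C_Sier X \<alpha>)) (\<alpha> - {{}})"
    by (rule strongly_Frechet_at_iff_selection[OF _ C_Sier_local_base[OF \<alpha>]])
      (simp_all add: topspace_C_Sier[OF \<alpha>(1)] opens_def)
  then have Sier: "strongly_Frechet_at (C_Sier X \<alpha>) (topspace X) \<longleftrightarrow>
    decreasing_selection (opens X) (\<alpha> - {{}})"
    by (simp only: topspace_C_Sier[OF \<alpha>(1)])
  have top: "topspace X \<in> \<A> \<longleftrightarrow> \<A> \<noteq> {}" if "\<A> \<in> \<alpha>" for \<A>
    using topspace_in_compact_family[of X \<A>] that \<alpha>(1) by (auto simp: kappa_def)
  have cover: "alpha_cover X \<alpha> \<Q> \<longleftrightarrow> \<Q> \<subseteq> opens X \<and> (\<forall>\<A>\<in>\<alpha> - {{}}. \<Q> \<inter> \<A> \<noteq> {})" for \<Q>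
    unfolding alpha_cover_def by (auto simp: top)
  have fin: "finite {n. P n \<notin> \<A>} \<longleftrightarrow> (\<forall>\<^sub>F n in sequentially. P n \<in> \<A>)"
    for P :: "nat \<Rightarrow> 'a set" and \<A>
    by (simp add: eventually_cofinite flip: cofinite_eq_sequentially)
  have nonempty: "(\<forall>\<A>\<in>\<alpha> - {{}}. R \<A>) \<longleftrightarrow> (\<forall>\<A>\<in>\<alpha>. \<A> \<noteq> {} \<longrightarrow> R \<A>)" for R
    by blast
  have "decreasing_selection (C_real_carrier X) (zero_boxes X \<alpha>) \<longleftrightarrow>
      decreasing_selection (opens X) (\<alpha> - {{}})"
    using Sier_selection_from_real[OF assms(1) \<alpha>(1)] real_selection_from_Sier[OF \<alpha>(1)] by (rule iffI)
  then show ?thesis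
    unfolding real Sier unfolding decreasing_selection_def[of "opens X"] cover fin nonempty
    by (intro conjI refl)
qed

end
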